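(* Let $G$ be a Polish non-locally-compact group admitting an invariant metric. Then there exists a statistical structure $\{(G,\mathcal{B}(G),\mu_\theta):\theta\in\Theta\}$ in $G$ which has an objective consistent estimate of the parameter $\theta$ such that: (i) $\Theta\subseteq G$ and $\mathrm{card}(\Theta)=2^{\aleph_0}$; (ii) $\mu_\theta$ is the restriction of the Dirac measure concentrated at the point $\theta$ to the Borel $\sigma$-algebra $\mathcal{B}(G)$ for each $\theta\in\Theta$.
   Context: $G$ is a Polish group: a separable group with a complete invariant metric $\rho$ (i.e. $\rho(fh_1g,fh_2g)=\rho(h_1,h_2)$ for all $f,g,h_1,h_2\in G$) for which the map $(x,y)\mapsto x^{-1}y$ from $G\times G$ onto $G$ is continuous. $\mathcal{B}(G)$ is the Borel $\sigma$-algebra of $G$. A Borel set $X\subseteq G$ is shy if there is a Borel probability measure $\mu$ on $G$ with $\mu(fXg)=0$ for all $f,g\in G$; a subset of a Borel shy set is also called shy. The complement of a shy set is prevalent. A Borel set is Haar ambivalent if it is neither shy nor prevalent. A statistical structure is a family of triplets $\{(G,\mathcal{B}(G),\mu_\theta):\theta\in\Theta\}$, where each $\mu_\theta$ is a Borel probability measure on $G$ and $\Theta$ is a non-empty set equipped with the $\sigma$-algebra $L(\Theta)$ generated by all singletons of $\Theta$. A $(\mathcal{B}(G),L(\Theta))$-measurable mapping $T:G\to\Theta$ is an objective consistent estimate of the parameter $\theta$ for this structure if (i) $\mu_\theta(T^{-1}(\theta))=1$ for each $\theta\in\Theta$, and (ii) $T^{-1}(\theta)$ is a Haar ambivalent set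 for each $\theta\in\Theta$. *)

theory Defs
  imports "HOL-Probability.Probability" "HOL-Library.Equipollence"
begin

text \<open>
  The group operation is written additively because that is the notation of the
  library class \<^class>\<open>group_add\<close>; this class does not assume commutativity, so
  \<open>f + x + g\<close> stands for \<open>f x g\<close> and \<open>- x\<close> for the inverse of \<open>x\<close>.  The complete
  two-sided invariant metric is the metric \<open>dist\<close> of \<^class>\<open>polish_space\<close>, which
  also determines the topology (and hence the Borel sets).  Joint continuity of
  \<open>(x, y) \<mapsto> - x + y\<close> is stated at each point with \<open>nhds x \<times>\<^sub>F nhds y\<close>, which is
  \<open>nhds (x, y)\<close> in the product topology; the product type itself cannot carry its
  topology inside a class specification.
\<close>

class polish_group = group_add + polish_space +
  assumes dist_invariant: "dist (f + h1 + g) (f + h2 + g) = dist h1 h2"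
    and continuous_diff:
      "filterlim (\<lambda>p. - fst p + snd p) (nhds (- x + y)) (nhds x \<times>\<^sub>F nhds y)"

definition borel_probability :: "'a::topological_space measure \<Rightarrow> bool" where
  "borel_probability \<mu> \<longleftrightarrow> prob_space \<mu> \<and> sets \<mu> = sets borel"

definition borel_shy :: "'a::polish_group set \<Rightarrow> bool" where
  "borel_shy X \<longleftrightarrow> X \<in> sets borel \<and>
     (\<exists>\<mu>. borel_probability \<mu> \<and> (\<forall>f g. emeasure \<mu> ((\<lambda>x. f + x + g) ` X) = 0))"

definition shy :: "'a::polish_group set \<Rightarrow> bool" where
  "shy X \<longleftrightarrow> (\<exists>B. borel_shy B \<and> X \<subseteq> B)"

definition prevalent :: "'a::polish_group set \<Rightarrow> bool" where
  "prevalent X \<longleftrightarrow> shy (- X)"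

definition haar_ambivalent :: "'a::polish_group set \<Rightarrow> bool" where
  "haar_ambivalent X \<longleftrightarrow> X \<in> sets borel \<and> \<not> shy X \<and> \<not> prevalent X"

definition statistical_structure ::
    "'b set \<Rightarrow> ('b \<Rightarrow> 'a::polish_group measure) \<Rightarrow> bool" where
  "statistical_structure \<Theta> \<mu> \<longleftrightarrow> \<Theta> \<noteq> {} \<and> (\<forall>\<theta>\<in>\<Theta>. borel_probability (\<mu> \<theta>))"

definition singleton_algebra :: "'b set \<Rightarrow> 'b measure" where
  "singleton_algebra \<Theta> = sigma \<Theta> {{\<theta>} |\<theta>. \<theta> \<in> \<Theta>}"

definition objective_consistent_estimate ::
    "'b set \<Rightarrow> ('b \<Rightarrow> 'a::polish_group measure) \<Rightarrow> ('a \<Rightarrow> 'b) \<Rightarrow> bool" where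
  "objective_consistent_estimate \<Theta> \<mu> T \<longleftrightarrow>
     T \<in> borel \<rightarrow>\<^sub>M singleton_algebra \<Theta> \<and>
     (\<forall>\<theta>\<in>\<Theta>. emeasure (\<mu> \<theta>) (T -` {\<theta>}) = 1) \<and>
     (\<forall>\<theta>\<in>\<Theta>. haar_ambivalent (T -` {\<theta>}))"

lemma polish_group_continuous:
  "continuous_on UNIV (\<lambda>(x :: 'a::polish_group, y). - x + y)"
  unfolding continuous_on_def
proof
  fix z :: "'a \<times> 'a"
  have "filterlim (\<lambda>p. - fst p + snd p) (nhds (- fst z + snd z)) (nhds z)"
    using continuous_diff[of "fst z" "snd z"] by (simp add: nhds_prod[symmetric])
  then show "((\<lambda>(x, y). - x + y) \<longlongrightarrow> (case z of (x, y) \<Rightarrow> - x + y)) (at z)"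
    by (simp add: case_prod_unfold at_within_def filterlim_inf filterlim_mono inf.coboundedI1
        tendsto_mono[OF inf_le1])
qed

end

theory Submission
  imports Defs
begin

text \<open>
  The idea is due to Solecki.  A group that is not locally compact has room, inside every
  ball around the identity, for infinitely many uniformly separated translations.  This makes
  it possible to choose Borel sets \<open>S 0, S 1, \<dots>\<close> so independent of each other that
  every fibre of the code \<open>y \<mapsto> (n \<mapsto> y \<in> S n)\<close>, one for each 0-1 sequence, contains a
  translate of some set of positive measure for every Borel probability measure
  (\<open>prescribed_code_positive_measure\<close>).  No fibre is then shy, and as a fibre lies in the
  complement of any other one, none is prevalent.  Picking one point \<open>\<theta>\<close> in every fibre and
  mapping a fibre to its point gives the estimate: the Dirac measure at \<open>\<theta>\<close> sees only the
  fibre of \<open>\<theta>\<close>, and there are as many fibres as sets of natural numbers.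

  The independence comes from an approximation in stages.  By tightness, a large part \<open>K\<close>
  of a given measure is covered, at every scale \<open>n\<close>, by small balls around the first
  \<open>m n\<close> points of a dense sequence, for some unknown \<open>m n\<close>.  Given a translation \<open>h\<close>
  reached so far, a small further correction depending on \<open>h\<close>, on \<open>m n\<close> and on the
  desired bit moves these finitely many balls to a place reserved for this request alone
  (\<open>next_level\<close>).  There are only countably many requests at each stage, and \<open>S n\<close>
  collects the places reserved for the bit \<open>True\<close>.  The corrections shrink geometrically, so
  completeness provides a limit translation \<open>z\<close>, and the code is the prescribed one on the
  whole of \<open>z + K\<close>.
\<close>

section \<open>Translations of a group with an invariant metric\<close>

lemma dist_add_left: "dist (a + x) (a + y) = dist x (y :: 'a::polish_group)"
  using dist_invariant[of a x 0 y] by simp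

lemma dist_add_right: "dist (x + a) (y + a) = dist x (y :: 'a::polish_group)"
  using dist_invariant[of 0 x a y] by simp

lemma continuous_on_add_left: "continuous_on A (\<lambda>x :: 'a::polish_group. a + x)"
  unfolding continuous_on_iff by (metis dist_add_left)

lemma vimage_add_left_borel:
  fixes a :: "'a::polish_group"
  assumes "B \<in> sets borel"
  shows "(\<lambda>x. a + x) -` B \<in> sets borel"
proof -
  have "(\<lambda>x. a + x) \<in> borel_measurable borel"
    by (rule borel_measurable_continuous_onI) (rule continuous_on_add_left)
  from measurable_sets[OF this assms] show ?thesis by simp
qed

section \<open>Separated sequences in small balls\<close>

text \<open>A compact ball around the identity would translate to a compact neighbourhood of every point.\<close>

lemma cball_not_compact:
  assumes "\<not> locally_compact_space (euclidean :: 'a::polish_group topology)" "r > 0"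
  shows "\<not> compact (cball (0::'a) r)"
proof
  assume c: "compact (cball (0::'a) r)"
  have "\<exists>U K. openin euclidean U \<and> compactin euclidean K \<and> x \<in> U \<and> U \<subseteq> K" for x :: 'a
  proof (intro exI conjI)
    show "openin euclidean (ball x r)" by simp
    show "compactin euclidean ((\<lambda>y. x + y) ` cball 0 r)"
      using compact_continuous_image[OF continuous_on_add_left c] by simp
    show "x \<in> ball x r" using assms(2) by simp
    show "ball x r \<subseteq> (\<lambda>y. x + y) ` cball 0 r"
    proof
      fix y assume "y \<in> ball x r"
      moreover have "dist 0 (- x + y) = dist x y"
        using dist_add_left[of x 0 "- x + y"] by (simp add: add.assoc[symmetric])
      ultimately have "- x + y \<in> cball 0 r" by simp
      moreover have "y = x + (- x + y)" by (simp add: add.assoc[symmetric])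
      ultimately show "y \<in> (\<lambda>y. x + y) ` cball 0 r" by blast
    qed
  qed
  then show False using assms(1) unfolding locally_compact_space_def by blast
qed

text \<open>
  Completeness makes total boundedness the only obstruction to compactness, so a closed
  ball contains a sequence that a greedy choice keeps uniformly separated.
\<close>

lemma separated_sequence_in_ball:
  assumes "\<not> locally_compact_space (euclidean :: 'a::polish_group topology)" "e > 0"
  obtains u :: "nat \<Rightarrow> 'a::polish_group" and d where "d > 0" "\<And>n. dist 0 (u n) < e"
    "\<And>m n. m \<noteq> n \<Longrightarrow> dist (u m) (u n) \<ge> d"
proof -
  let ?C = "cball (0::'a) (e/2)"
  have "\<not> compact ?C" using assms(2) by (intro cball_not_compact[OF assms(1)]) simp
  then obtain d where d: "d > 0" "\<And>k. finite k \<Longrightarrow> \<not> ?C \<subseteq> (\<Union>x\<in>k. ball x d)"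
    using closed_cball unfolding compact_eq_totally_bounded complete_eq_closed by blast
  have "\<exists>u. \<forall>n::nat. u n \<in> ?C \<and> (\<forall>m<n. \<not> dist (u m) (u n) < d)"
  proof (rule dependent_wellorder_choice)
    fix n :: nat and u :: "nat \<Rightarrow> 'a"
    have "finite (u ` {..<n})" by simp
    from d(2)[OF this] show "\<exists>r. r \<in> ?C \<and> (\<forall>m<n. \<not> dist (u m) r < d)"
      by (auto simp: subset_eq)
  qed auto
  then obtain u :: "nat \<Rightarrow> 'a" where u: "\<And>n. u n \<in> ?C" "\<And>m n. m < n \<Longrightarrow> d \<le> dist (u m) (u n)"
    unfolding not_less by metis
  have "d \<le> dist (u m) (u n)" if "m \<noteq> n" for m n
    using that u(2)[of m n] u(2)[of n m] by (cases m n rule: linorder_cases) (auto simp: dist_commute)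
  moreover have "dist 0 (u n) < e" for n using u(1)[of n] assms(2) by (auto simp del: dist_0_norm)
  ultimately show thesis using that d(1) by blast
qed

text \<open>
  Two-sided invariance enters here: \<open>x \<mapsto> a + x + v\<close> is an isometry, so for every
  \<open>v\<close> and every forbidden point \<open>p\<close> at most one term of the sequence is lost.
\<close>

lemma separated_sequence_avoids_finite:
  fixes u :: "nat \<Rightarrow> 'a::polish_group"
  assumes sep: "\<And>m n. m \<noteq> n \<Longrightarrow> dist (u m) (u n) \<ge> d"
    and fin: "finite V" "finite P"
  obtains k where "\<And>v p. v \<in> V \<Longrightarrow> p \<in> P \<Longrightarrow> dist (a + u k + v) p \<ge> d / 2"
proof -
  define bad where "bad v p = {k. dist (a + u k + v) p < d / 2}" for v p
  have "finite (bad v p)" for v p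
  proof (cases "bad v p = {}")
    case False
    then obtain k where k: "k \<in> bad v p" by blast
    have "bad v p \<subseteq> {k}"
    proof
      fix l assume "l \<in> bad v p"
      with k have "dist (a + u l + v) (a + u k + v) < d"
        unfolding bad_def by (smt (verit) dist_triangle2 field_sum_of_halves mem_Collect_eq)
      then have "dist (u l) (u k) < d" by (simp add: dist_invariant)
      then show "l \<in> {k}" using sep[of l k] by force
    qed
    then show ?thesis by (rule finite_subset) simp
  qed simp
  then have "finite (\<Union>v\<in>V. \<Union>p\<in>P. bad v p)" using fin by blast
  then obtain k where "k \<notin> (\<Union>v\<in>V. \<Union>p\<in>P. bad v p)"
    using infinite_UNIV_nat by (metis UNIV_eq_I)
  then show thesis using that[of k] unfolding bad_def by (auto simp: not_less)
qed

section \<open>One level of the construction\<close>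

text \<open>
  Requests are served in the order of their numbers: request \<open>c\<close> asks for a point near
  \<open>h c\<close> whose translates of \<open>q 0, \<dots>, q (w c)\<close> keep away from everything placed before.
  Only finitely many points are in the way at each moment.
\<close>

lemma separated_translates:
  fixes h q :: "nat \<Rightarrow> 'a::polish_group" and w :: "nat \<Rightarrow> nat"
  assumes nlc: "\<not> locally_compact_space (euclidean :: 'a topology)" and "e > 0"
  obtains g :: "nat \<Rightarrow> 'a::polish_group" and d where "d > 0" "\<And>c. dist (h c) (g c) < e"
    "\<And>c c' i i'. \<lbrakk>c \<noteq> c'; i \<le> w c; i' \<le> w c'\<rbrakk> \<Longrightarrow> dist (g c + q i) (g c' + q i') \<ge> d"
proof -
  obtain u :: "nat \<Rightarrow> 'a" and d where d: "d > 0" and u: "\<And>n. dist 0 (u n) < e"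
    and sep: "\<And>m n. m \<noteq> n \<Longrightarrow> dist (u m) (u n) \<ge> d"
    using separated_sequence_in_ball[OF nlc \<open>e > 0\<close>] by metis
  define P where "P g c x \<longleftrightarrow> dist (h c) x < e \<and>
    (\<forall>c'<c. \<forall>i\<in>{..w c}. \<forall>i'\<in>{..w c'}. dist (x + q i) (g c' + q i') \<ge> d / 2)"
    for g :: "nat \<Rightarrow> 'a" and c x
  \<comment> \<open>It suffices to look back at smaller requests, since the distance is symmetric.\<close>
  have "\<exists>g. \<forall>c. P g c (g c)"
  proof (rule dependent_wellorder_choice)
    fix c and g :: "nat \<Rightarrow> 'a"
    let ?Q = "\<Union>c'<c. (\<lambda>i'. g c' + q i') ` {..w c'}"
    obtain k where k: "\<And>v p. v \<in> q ` {..w c} \<Longrightarrow> p \<in> ?Q \<Longrightarrow> dist (h c + u k + v) p \<ge> d / 2"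
      using separated_sequence_avoids_finite[where u = u and d = d and a = "h c" and V = "q ` {..w c}" and P = ?Q] sep by auto
    have "dist (h c) (h c + u k) < e" using u[of k] dist_add_left[of "h c" 0 "u k"] by simp
    with k have "P g c (h c + u k)" unfolding P_def by blast
    then show "\<exists>x. P g c x" by blast
  qed (simp add: P_def)
  then obtain g where g: "\<And>c. P g c (g c)" by blast
  show thesis
  proof (rule that)
    show "d / 2 > 0" using d by simp
    show "dist (h c) (g c) < e" for c using g[of c] unfolding P_def by blast
    show "dist (g c + q i) (g c' + q i') \<ge> d / 2" if "c \<noteq> c'" "i \<le> w c" "i' \<le> w c'" for c c' i i'
    proof (cases "c' < c")
      case True
      then show ?thesis using g[of c] that unfolding P_def by auto
    next
      case False
      then have "c < c'" using that by simp
      then show ?thesis using g[of c'] that unfolding P_def by (auto simp: dist_commute)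
    qed
  qed
qed

text \<open>
  The passage from one level to the next.  The old points \<open>h\<close> are approximate translations
  reached so far; every \<open>h j\<close> can be corrected by less than \<open>e\<close> so that the
  translates of the small balls around \<open>q 0, \<dots>, q m\<close> all fall into \<open>S\<close>, or
  all into its complement, as prescribed by the bit \<open>b\<close>.  The factor 4 leaves room for the
  radius \<open>e'\<close> of a cover and for all later corrections, whose sum is at most \<open>2 * e'\<close>.
\<close>

lemma next_level:
  fixes h q :: "nat \<Rightarrow> 'a::polish_group"
  assumes nlc: "\<not> locally_compact_space (euclidean :: 'a topology)" and "e > 0"
  obtains h' :: "nat \<Rightarrow> 'a::polish_group" and e' S where "e' > 0" "e' \<le> e / 2" "S \<in> sets borel"
    "\<And>j m b. \<exists>k. dist (h j) (h' k) < e \<and> (\<forall>i\<le>m. \<forall>y\<in>cball (h' k + q i) (4 * e'). (y \<in> S) = b)"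
proof -
  \<comment> \<open>A request \<open>(j, m, b)\<close> is coded by the number \<open>code j m b\<close>.\<close>
  define code where "code j m b = to_nat (j :: nat, m :: nat, b :: bool)" for j m b
  define old :: "nat \<Rightarrow> nat" where "old c = fst (from_nat c :: nat \<times> nat \<times> bool)" for c
  define num :: "nat \<Rightarrow> nat" where "num c = fst (snd (from_nat c :: nat \<times> nat \<times> bool))" for c
  define bit where "bit c = snd (snd (from_nat c :: nat \<times> nat \<times> bool))" for c
  have code: "old (code j m b) = j" "num (code j m b) = m" "bit (code j m b) = b" for j m b
    by (simp_all add: code_def old_def num_def bit_def)
  obtain g d where d: "d > 0" and g: "\<And>c. dist (h (old c)) (g c) < e"
    and sep: "\<And>c c' i i'. \<lbrakk>c \<noteq> c'; i \<le> num c; i' \<le> num c'\<rbrakk> \<Longrightarrow> dist (g c + q i) (g c' + q i') \<ge> d"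
    using separated_translates[OF nlc \<open>e > 0\<close>, of "\<lambda>c. h (old c)" num q] by metis
  \<comment> \<open>Two balls of radius \<open>4 * e'\<close> about points at distance \<open>d\<close> must be disjoint.\<close>
  define e' where "e' = min (e / 2) (d / 16)"
  define S where "S = (\<Union>c\<in>{c. bit c}. \<Union>i\<in>{..num c}. cball (g c + q i) (4 * e'))"
  have e': "e' > 0" "e' \<le> e / 2" "8 * e' < d" using d \<open>e > 0\<close> by (auto simp: e'_def)
  show thesis
  proof (rule that)
    show "e' > 0" "e' \<le> e / 2" by fact+
    show "S \<in> sets borel" unfolding S_def by (intro sets.countable_UN') auto
    show "\<exists>k. dist (h j) (g k) < e \<and> (\<forall>i\<le>m. \<forall>y\<in>cball (g k + q i) (4 * e'). (y \<in> S) = b)" for j m b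
    proof (intro exI conjI allI impI ballI)
      let ?c = "code j m b"
      show "dist (h j) (g ?c) < e" using g[of ?c] by (simp add: code)
      fix i y assume i: "i \<le> m" and y: "y \<in> cball (g ?c + q i) (4 * e')"
      show "(y \<in> S) = b"
      proof (cases b)
        case True
        then have "y \<in> S" unfolding S_def using i y by (intro UN_I[of ?c] UN_I[of i]) (auto simp: code)
        with True show ?thesis by simp
      next
        case False
        have "y \<notin> S"
        proof
          assume "y \<in> S"
          then obtain c i' where c: "bit c" "i' \<le> num c" "y \<in> cball (g c + q i') (4 * e')"
            unfolding S_def by auto
          have "c \<noteq> ?c" using c(1) False code by metis
          then have "dist (g c + q i') (g ?c + q i) \<ge> d" using sep c(2) i by (simp add: code)
          moreover have "dist (g c + q i') (g ?c + q i) \<le> 8 * e'"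
            using c(3) y dist_triangle2[of "g c + q i'" "g ?c + q i" y] by simp
          ultimately show False using e'(3) by simp
        qed
        then show ?thesis using False by simp
      qed
    qed
  qed
qed

section \<open>The Borel code of a point\<close>

text \<open>
  Iteration of \<open>next_level\<close>.  The points \<open>h n\<close> form a countably branching tree whose branches
  are chosen only later, when a measure and a 0-1 sequence are given; the sets \<open>S n\<close> must not
  depend on them.
\<close>

lemma level_sets_exist:
  fixes q :: "nat \<Rightarrow> 'a::polish_group"
  assumes nlc: "\<not> locally_compact_space (euclidean :: 'a topology)"
  obtains h :: "nat \<Rightarrow> nat \<Rightarrow> 'a::polish_group" and e :: "nat \<Rightarrow> real" and S :: "nat \<Rightarrow> 'a::polish_group set" where
    "\<And>n. e n > 0" "\<And>n. e (Suc n) \<le> e n / 2" "\<And>n. S n \<in> sets borel"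
    "\<And>n j m b. \<exists>k. dist (h n j) (h (Suc n) k) < e n \<and>
       (\<forall>i\<le>m. \<forall>y\<in>cball (h (Suc n) k + q i) (4 * e (Suc n)). (y \<in> S n) = b)"
proof -
  define R where "R s t \<longleftrightarrow> (case (s, t) of ((h, e, _), (h', e', S)) \<Rightarrow>
      e' \<le> e / 2 \<and> S \<in> sets borel \<and>
      (\<forall>j m b. \<exists>k. dist (h j) (h' k) < e \<and> (\<forall>i\<le>m. \<forall>y\<in>cball (h' k + q i) (4 * e'). (y \<in> S) = b)))"
    for s t :: "(nat \<Rightarrow> 'a) \<times> real \<times> 'a set"
  have "\<exists>f. \<forall>n::nat. fst (snd (f n)) > 0 \<and> R (f n) (f (Suc n))"
  proof (rule dependent_nat_choice)
    show "\<exists>s::(nat \<Rightarrow> 'a) \<times> real \<times> 'a set. fst (snd s) > 0"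
      by (rule exI[of _ "(\<lambda>_. 0, 1, {})"]) simp
    fix s :: "(nat \<Rightarrow> 'a) \<times> real \<times> 'a set" and n :: nat
    assume s: "fst (snd s) > 0"
    obtain h e S0 where [simp]: "s = (h, e, S0)" by (cases s)
    have "e > 0" using s by simp
    obtain h' :: "nat \<Rightarrow> 'a" and e' S where "e' > 0" "e' \<le> e / 2" "S \<in> sets borel"
      "\<And>j m b. \<exists>k. dist (h j) (h' k) < e \<and> (\<forall>i\<le>m. \<forall>y\<in>cball (h' k + q i) (4 * e'). (y \<in> S) = b)"
      by (rule next_level[OF nlc \<open>e > 0\<close>, of h q]) blast
    then show "\<exists>t. fst (snd t) > 0 \<and> R s t"
      by (intro exI[of _ "(h', e', S)"]) (simp add: R_def)
  qed
  then obtain f where f: "\<And>n. fst (snd (f n)) > 0" "\<And>n::nat. R (f n) (f (Suc n))" by blast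
  show thesis
    by (rule that[of "\<lambda>n. fst (snd (f n))" "\<lambda>n. snd (snd (f (Suc n)))" "\<lambda>n. fst (f n)"])
      (use f in \<open>auto simp: R_def case_prod_unfold\<close>)
qed

text \<open>
  The usual tightness argument, stopped before compactness: finite covers at all prescribed
  scales are what the construction uses.
\<close>

lemma borel_probability_finite_covers:
  fixes q :: "nat \<Rightarrow> 'a::polish_space"
  assumes \<mu>: "borel_probability \<mu>"
    and dense: "\<And>x r. r > 0 \<Longrightarrow> \<exists>i. dist x (q i) < r"
    and r: "\<And>n. r n > 0"
  obtains m :: "nat \<Rightarrow> nat" and K where "K \<in> sets borel" "emeasure \<mu> K > 0"
    "\<And>n x. x \<in> K \<Longrightarrow> \<exists>i\<le>m n. dist x (q i) < r n"
proof -
  interpret prob_space \<mu> using \<mu> by (simp add: borel_probability_def)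
  have sets: "sets \<mu> = sets borel" using \<mu> by (simp add: borel_probability_def)
  have space: "space \<mu> = UNIV" using sets_eq_imp_space_eq[OF sets] by simp
  define A where "A n m = (\<Union>i\<in>{..m}. ball (q i) (r n))" for n and m :: nat
  have A: "A n m \<in> sets \<mu>" for n m unfolding A_def sets by (intro borel_open) auto
  have "\<exists>m. prob (A n m) > 1 - (1/2)^Suc (Suc n)" for n
  proof -
    have "(\<lambda>m. prob (A n m)) \<longlonglongrightarrow> prob (\<Union>m. A n m)"
      by (rule finite_Lim_measure_incseq) (use A in \<open>auto simp: A_def incseq_def\<close>, fastforce)
    moreover have "(\<Union>m. A n m) = space \<mu>"
      unfolding space A_def using dense[OF r[of n]] by (fastforce simp: dist_commute)
    ultimately have "(\<lambda>m. prob (A n m)) \<longlonglongrightarrow> 1" by (simp add: prob_space)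
    then have "eventually (\<lambda>m. prob (A n m) > 1 - (1/2)^Suc (Suc n)) sequentially"
      by (rule order_tendstoD(1)) simp
    then show ?thesis by (rule eventually_happens'[OF sequentially_bot])
  qed
  then obtain m where m: "\<And>n. prob (A n (m n)) > 1 - (1/2)^Suc (Suc n)" by metis
  define K where "K = (\<Inter>n. A n (m n))"
  have K: "K \<in> sets \<mu>" unfolding K_def using A by auto
  have sums: "(\<lambda>n. (1/2::real)^Suc (Suc n)) sums (1/2)"
    using sums_mult[OF geometric_sums[of "1/2::real"], of "1/4"] by simp
  have le: "prob (space \<mu> - A n (m n)) \<le> (1/2)^Suc (Suc n)" for n
    using m[of n] prob_compl[OF A[of n "m n"]] by simp
  \<comment> \<open>The losses at all scales together are at most \<open>1/4 + 1/8 + \<dots> = 1/2\<close>.\<close>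
  have summ: "summable (\<lambda>n. prob (space \<mu> - A n (m n)))"
    by (rule summable_comparison_test'[OF sums_summable[OF sums]]) (use le in auto)
  have "prob (space \<mu> - K) = prob (\<Union>n. space \<mu> - A n (m n))"
    unfolding K_def by (intro arg_cong[of _ _ prob]) auto
  also have "\<dots> \<le> (\<Sum>n. prob (space \<mu> - A n (m n)))"
    by (rule finite_measure_subadditive_countably) (use A summ in auto)
  also have "\<dots> \<le> (\<Sum>n. (1/2)^Suc (Suc n))"
    by (rule suminf_le[OF le summ sums_summable[OF sums]])
  also have "\<dots> = 1/2" using sums_unique[OF sums] by simp
  finally have "prob K > 0" using prob_compl[OF K] by simp
  then have "emeasure \<mu> K > 0" by (simp add: emeasure_eq_measure)
  moreover have "\<exists>i\<le>m n. dist x (q i) < r n" if "x \<in> K" for n x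
    using that unfolding K_def A_def by (auto simp: dist_commute)
  ultimately show thesis using that K sets by metis
qed

lemma geometric_steps_converge:
  fixes z :: "nat \<Rightarrow> 'a::polish_space"
  assumes e: "\<And>n. e n > 0" "\<And>n. e (Suc n) \<le> e n / 2"
    and z: "\<And>n. dist (z n) (z (Suc n)) < e n"
  obtains l where "\<And>n. dist (z n) l \<le> 2 * e n"
proof -
  have step: "dist (z n) (z (n + k)) \<le> 2 * e n - 2 * e (n + k)" for n k
  proof (induction k)
    case (Suc k)
    have "dist (z n) (z (n + Suc k)) \<le> dist (z n) (z (n + k)) + dist (z (n + k)) (z (Suc (n + k)))"
      by (simp add: dist_triangle)
    then show ?case using Suc z[of "n + k"] e(2)[of "n + k"] by simp
  qed simp
  have bound: "dist (z n) (z p) \<le> 2 * e n" if "n \<le> p" for n p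
    using step[of n "p - n"] e(1)[of p] that by simp
  have small: "e n \<le> e 0 * (1/2)^n" for n
    by (induction n) (use e(2) in \<open>auto intro: order_trans\<close>)
  have "(\<lambda>n. e 0 * (1/2)^n) \<longlonglongrightarrow> 0"
    by (intro tendsto_mult_right_zero LIMSEQ_power_zero) simp
  then have lim: "e \<longlonglongrightarrow> 0"
    by (rule Lim_null_comparison[rotated]) (use small e(1) in \<open>auto simp: less_imp_le\<close>)
  have "Cauchy z"
  proof (rule metric_CauchyI)
    fix r :: real assume "r > 0"
    then have "eventually (\<lambda>n. e n < r / 4) sequentially"
      using lim by (intro order_tendstoD) auto
    then obtain N where N: "e N < r / 4" by (auto dest: eventually_happens)
    have "dist (z m) (z n) < r" if "m \<ge> N" "n \<ge> N" for m n
      using bound[OF that(1)] bound[OF that(2)] N dist_triangle3[of "z m" "z n" "z N"] by linarith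
    then show "\<exists>M. \<forall>m\<ge>M. \<forall>n\<ge>M. dist (z m) (z n) < r" by blast
  qed
  then obtain l where l: "z \<longlonglongrightarrow> l" by (auto simp: Cauchy_convergent_iff convergent_def)
  have "dist (z n) l \<le> 2 * e n" for n
  proof (rule LIMSEQ_le_const2)
    show "(\<lambda>p. dist (z n) (z p)) \<longlonglongrightarrow> dist (z n) l" by (intro tendsto_intros l)
    show "\<exists>N. \<forall>p\<ge>N. dist (z n) (z p) \<le> 2 * e n" using bound by blast
  qed
  then show thesis using that by blast
qed

text \<open>
  The heart of the proof: the scales of the tree of translations are fixed in advance, tightness
  of the measure tells how many balls \<open>K\<close> needs at these scales, and this number and the
  prescribed bit select a branch of the tree, which converges to \<open>z\<close>.
\<close>

lemma prescribed_code_positive_measure: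
  assumes nlc: "\<not> locally_compact_space (euclidean :: 'a::polish_group topology)"
  obtains S :: "nat \<Rightarrow> 'a::polish_group set" where "\<And>n. S n \<in> sets borel"
    "\<And>\<mu> x. borel_probability \<mu> \<Longrightarrow>
       \<exists>z K. K \<in> sets borel \<and> emeasure \<mu> K > 0 \<and> (\<forall>y\<in>K. \<forall>n. (z + y \<in> S n) = x n)"
proof -
  obtain D :: "'a set" where D: "countable D" "\<And>X. open X \<Longrightarrow> X \<noteq> {} \<Longrightarrow> \<exists>d\<in>D. d \<in> X"
    using countable_dense_exists[where 'a='a] by blast
  have "D \<noteq> {}" using D(2)[of UNIV] by auto
  define q where "q = from_nat_into D"
  have dense: "\<exists>i. dist x (q i) < r" if "r > 0" for x r
  proof -
    have "ball x r \<noteq> {}" using that by simp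
    then obtain d where "d \<in> D" "d \<in> ball x r" using D(2)[OF open_ball, of x r] by blast
    moreover have "range q = D" unfolding q_def by (rule range_from_nat_into) fact+
    ultimately show ?thesis by (metis mem_ball rangeE)
  qed
  obtain h :: "nat \<Rightarrow> nat \<Rightarrow> 'a" and e and S :: "nat \<Rightarrow> 'a set" where e: "\<And>n. e n > 0" "\<And>n. e (Suc n) \<le> e n / 2"
    and S: "\<And>n. S n \<in> sets borel"
    and h: "\<And>n j m b. \<exists>k. dist (h n j) (h (Suc n) k) < e n \<and>
       (\<forall>i\<le>m. \<forall>y\<in>cball (h (Suc n) k + q i) (4 * e (Suc n)). (y \<in> S n) = b)"
    by (rule level_sets_exist[OF nlc, of q]) blast
  have "\<exists>z K. K \<in> sets borel \<and> emeasure \<mu> K > 0 \<and> (\<forall>y\<in>K. \<forall>n. (z + y \<in> S n) = x n)"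
    if \<mu>: "borel_probability \<mu>" for \<mu> x
  proof -
    obtain m K where K: "K \<in> sets borel" "emeasure \<mu> K > 0"
      and m: "\<And>n y. y \<in> K \<Longrightarrow> \<exists>i\<le>m n. dist y (q i) < e (Suc n)"
      using borel_probability_finite_covers[OF \<mu> dense, of "\<lambda>n. e (Suc n)"] e(1) by metis
    have "\<exists>k. \<forall>n::nat. True \<and> (dist (h n (k n)) (h (Suc n) (k (Suc n))) < e n \<and>
       (\<forall>i\<le>m n. \<forall>y\<in>cball (h (Suc n) (k (Suc n)) + q i) (4 * e (Suc n)). (y \<in> S n) = x n))"
      by (rule dependent_nat_choice) (use h in auto)
    then obtain k where k: "\<And>n. dist (h n (k n)) (h (Suc n) (k (Suc n))) < e n"
      "\<And>n i y. i \<le> m n \<Longrightarrow> y \<in> cball (h (Suc n) (k (Suc n)) + q i) (4 * e (Suc n)) \<Longrightarrow> (y \<in> S n) = x n"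
      by blast
    obtain z where z: "\<And>n. dist (h n (k n)) z \<le> 2 * e n"
      using geometric_steps_converge[of e "\<lambda>n. h n (k n)"] e k(1) by metis
    have "(z + y \<in> S n) = x n" if "y \<in> K" for y n
    proof -
      let ?z = "h (Suc n) (k (Suc n))"
      obtain i where i: "i \<le> m n" "dist y (q i) < e (Suc n)" using m[OF \<open>y \<in> K\<close>] by blast
      \<comment> \<open>Invariance on both sides: the left factor moves by at most \<open>2 * e (Suc n)\<close>, the right one by \<open>e (Suc n)\<close>.\<close>
      have "dist (?z + q i) (z + y) \<le> dist (?z + q i) (?z + y) + dist (?z + y) (z + y)"
        by (rule dist_triangle)
      also have "\<dots> = dist y (q i) + dist ?z z"
        by (simp add: dist_add_left dist_add_right dist_commute)
      also have "\<dots> \<le> 4 * e (Suc n)" using i(2) z[of "Suc n"] e(1)[of "Suc n"] by simp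
      finally show ?thesis using k(2)[OF i(1)] by simp
    qed
    then show ?thesis using K by blast
  qed
  then show thesis using that S by blast
qed

section \<open>Ambivalence of the fibres and the estimate\<close>

text \<open>
  The translate \<open>z + K\<close> lies in every Borel set that contains \<open>X\<close>; translating such a set
  back by \<open>- z\<close> produces a set that contains \<open>K\<close>.
\<close>

lemma not_shy_if_translates_positive:
  fixes X :: "'a::polish_group set"
  assumes "\<And>\<mu>. borel_probability \<mu> \<Longrightarrow>
    \<exists>z K. K \<in> sets borel \<and> emeasure \<mu> K > 0 \<and> (\<forall>y\<in>K. z + y \<in> X)"
  shows "\<not> shy X"
proof
  assume "shy X"
  then obtain B \<mu> where B: "X \<subseteq> B" "B \<in> sets borel" and \<mu>: "borel_probability \<mu>"
    and zero: "\<And>f g. emeasure \<mu> ((\<lambda>x. f + x + g) ` B) = 0"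
    unfolding shy_def borel_shy_def by blast
  obtain z K where K: "emeasure \<mu> K > 0" "\<And>y. y \<in> K \<Longrightarrow> z + y \<in> X"
    using assms[OF \<mu>] by blast
  have eq: "(\<lambda>x. - z + x + 0) ` B = (\<lambda>y. z + y) -` B"
    by (auto simp: image_iff add.assoc[symmetric] intro!: bexI[of _ "z + _"])
  have "(\<lambda>y. z + y) -` B \<in> sets \<mu>"
    using vimage_add_left_borel[OF B(2)] \<mu> by (simp add: borel_probability_def)
  moreover have "K \<subseteq> (\<lambda>y. z + y) -` B" using K(2) B(1) by auto
  ultimately have "emeasure \<mu> K \<le> emeasure \<mu> ((\<lambda>y. z + y) -` B)" by (rule emeasure_mono[rotated])
  then show False using K(1) zero[of "- z" 0] unfolding eq by simp
qed

lemma nat_predicates_eqpoll_nat_sets: "(UNIV :: (nat \<Rightarrow> bool) set) \<approx> (UNIV :: nat set set)"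
  unfolding eqpoll_def
  by (rule exI[of _ Collect]) (auto simp: bij_betw_def inj_on_def intro!: range_eqI[of _ _ "\<lambda>n. n \<in> _"])

lemma borel_probability_return: "borel_probability (return borel \<theta>)"
  by (simp add: borel_probability_def prob_space_return)

theorem theorem6p19:
  assumes "\<not> locally_compact_space (euclidean :: 'a::polish_group topology)"
  shows "\<exists>(\<Theta> :: 'a set) (\<mu> :: 'a \<Rightarrow> 'a measure).
           statistical_structure \<Theta> \<mu> \<and>
           (\<exists>T. objective_consistent_estimate \<Theta> \<mu> T) \<and>
           \<Theta> \<approx> (UNIV :: nat set set) \<and>
           (\<forall>\<theta>\<in>\<Theta>. \<mu> \<theta> = return borel \<theta>)"
proof -
  obtain S :: "nat \<Rightarrow> 'a set" where S: "\<And>n. S n \<in> sets borel"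
    and big: "\<And>\<mu> x. borel_probability \<mu> \<Longrightarrow>
       \<exists>z K. K \<in> sets borel \<and> emeasure \<mu> K > 0 \<and> (\<forall>y\<in>K. \<forall>n. (z + y \<in> S n) = x n)"
    using prescribed_code_positive_measure[OF assms] by metis
  define code where "code y = (\<lambda>n. y \<in> S n)" for y
  have borel: "code -` {x} \<in> sets borel" for x
  proof -
    define A where "A n = (if x n then S n else - S n)" for n
    have "y \<in> A n \<longleftrightarrow> (y \<in> S n) = x n" for y n by (simp add: A_def)
    then have "code -` {x} = (\<Inter>n. A n)" by (auto simp: code_def fun_eq_iff)
    also have "\<dots> \<in> sets borel"
      by (rule sets.countable_INT'') (use S in \<open>auto simp: A_def borel_comp\<close>)
    finally show ?thesis .
  qed
  have not_shy: "\<not> shy (code -` {x})" for x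
    using big[of _ x] by (intro not_shy_if_translates_positive) (auto simp: code_def fun_eq_iff)
  have ambivalent: "haar_ambivalent (code -` {x})" for x
  proof -
    have "code -` {\<lambda>n. \<not> x n} \<subseteq> - code -` {x}" by (auto simp: fun_eq_iff)
    then have "\<not> prevalent (code -` {x})"
      using not_shy[of "\<lambda>n. \<not> x n"] unfolding prevalent_def shy_def by blast
    then show ?thesis using borel not_shy by (simp add: haar_ambivalent_def)
  qed
  \<comment> \<open>A set of positive measure is nonempty; any Dirac measure will do.\<close>
  have "\<exists>y. code y = x" for x
  proof -
    obtain z K where "emeasure (return borel (0::'a)) K > 0" and K: "\<forall>y\<in>K. \<forall>n. (z + y \<in> S n) = x n"
      using big[OF borel_probability_return[of "0::'a"], of x] by blast
    then have "K \<noteq> {}" by auto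
    then obtain y where "y \<in> K" by blast
    with K have "code (z + y) = x" by (simp add: code_def)
    then show ?thesis by blast
  qed
  then obtain pt where pt: "\<And>x. code (pt x) = x" by metis
  define \<Theta> where "\<Theta> = range pt"
  define T where "T = pt \<circ> code"
  have fibre: "T -` {pt x} = code -` {x}" for x
    unfolding T_def by (auto) (metis pt)
  have "T \<in> borel \<rightarrow>\<^sub>M singleton_algebra \<Theta>"
    unfolding singleton_algebra_def
    by (rule measurable_measure_of) (auto simp: \<Theta>_def T_def fibre[unfolded T_def] borel)
  moreover have "emeasure (return borel (pt x)) (T -` {pt x}) = 1" for x
    using borel[of x] by (simp add: fibre emeasure_return pt)
  ultimately have "objective_consistent_estimate \<Theta> (return borel) T"
    using ambivalent by (auto simp: objective_consistent_estimate_def \<Theta>_def fibre)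
  moreover have "statistical_structure \<Theta> (return borel)"
    by (auto simp: statistical_structure_def \<Theta>_def borel_probability_return)
  moreover have "\<Theta> \<approx> (UNIV :: nat set set)"
  proof -
    have "inj pt" by (metis injI pt)
    then have "\<Theta> \<approx> (UNIV :: (nat \<Rightarrow> bool) set)"
      unfolding \<Theta>_def by (simp add: inj_on_image_eqpoll_self)
    then show ?thesis using nat_predicates_eqpoll_nat_sets by (rule eqpoll_trans)
  qed
  ultimately show ?thesis by blast
qed

end
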